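(* Let $\mathsf{K}$ and $\mathsf{L}$ be bounded, distributive lattices, and let $h:\mathsf{K}\to\mathsf{L}$ be a lattice epimorphism. If $h$ is spacious and $h^{-1}(1)=\{1\}$, then for every finite poset $\mathsf{P}$, every lattice embedding $s:\mathsf{O}(\mathsf{P})\to\mathsf{L}$ admits a lift through $h$, i.e. there is a lattice homomorphism $k:\mathsf{O}(\mathsf{P})\to\mathsf{K}$ with $h\circ k=s$.
   Context: Homomorphisms of bounded lattices are required to preserve $0$ and $1$; sublattices are required to contain $0$ and $1$. An epimorphism is a surjective lattice homomorphism; an embedding is an injective lattice homomorphism. For a finite poset $\mathsf{P}$, $\mathsf{O}(\mathsf{P})$ is the bounded distributive lattice of down-sets of $\mathsf{P}$ with $\vee=\cup$, $\wedge=\cap$, $0=\varnothing$, $1=\mathsf{P}$; $\downarrow q=\{p\in\mathsf{P}:p\le q\}$. For $\lambda\in\mathsf{O}(\mathsf{P})$, $\mathsf{O}(\lambda^\top)$ denotes the sublattice $\{\alpha\in\mathsf{O}(\mathsf{P}):\alpha\subset\lambda\text{ or }\alpha=\mathsf{P}\}$ of $\mathsf{O}(\mathsf{P})$. Let $s:\mathsf{O}(\mathsf{P})\to\mathsf{L}$ be a lattice embedding. A partial lift of $s$ on $\mathsf{O}(\lambda^\top)$ is a lattice homomorphism $k:\mathsf{O}(\lambda^\top)\to\mathsf{K}$ (so $k(0)=0$ and $k(\mathsf{P})=1$) such that $h(k(\beta))=s(\beta)$ for all $\beta\in\mathsf{O}(\mathsf{P})$ with $\beta\subset\lambda$. A partial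 lift $k$ on $\mathsf{O}(\lambda^\top)$ is a conditional lift if there exist elements $v_\alpha\in h^{-1}(s(\alpha))$, $\alpha\in\mathsf{O}(\mathsf{P})$, such that for every $\alpha\in\mathsf{O}(\mathsf{P})$ one has $k(\gamma)\wedge v_\alpha\le k(\beta)$ for all $\beta,\gamma\in\mathsf{O}(\mathsf{P})$ with $\beta,\gamma\subset\lambda$ and $\gamma\cap\alpha\subset\beta$. The epimorphism $h$ is spacious if for every finite poset $\mathsf{P}$ and every lattice embedding $s:\mathsf{O}(\mathsf{P})\to\mathsf{L}$ the following hold: (i) for every minimal $q\in\mathsf{P}$, every partial lift $k:\mathsf{O}(\{q\}^\top)\to\mathsf{K}$ of $s$ on $\mathsf{O}(\{q\}^\top)$ is a conditional lift; (ii) for every $\lambda\in\mathsf{O}(\mathsf{P})$, every partial lift $k:\mathsf{O}(\lambda^\top)\to\mathsf{K}$ of $s$ on $\mathsf{O}(\lambda^\top)$, and every minimal element $q$ of $\mathsf{P}\setminus\lambda$, writing $\mu=\downarrow q$, there exist $v_\mu\in h^{-1}(s(\mu))$ and elements $v_\alpha\in h^{-1}(s(\alpha))$ for all $\alpha\in\mathsf{O}(\mathsf{P})$ with $q\notin\alpha$, such that $v_\mu\wedge v_\alpha\le k(\lambda)$ for all such $\alpha$. *)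

theory Defs
  imports Main
begin

text \<open>A finite poset is a finite carrier \<open>P\<close> with a relation \<open>r\<close> such that \<open>partial_order_on P r\<close>,
  where \<open>(x, y) \<in> r\<close> means \<open>x \<le> y\<close>; in particular \<open>r \<subseteq> P \<times> P\<close>, so the principal
  down-set of \<open>q\<close> is \<open>under r q\<close>.\<close>

definition downsets :: "'a set \<Rightarrow> 'a rel \<Rightarrow> 'a set set" where
  "downsets P r = {\<alpha>. \<alpha> \<subseteq> P \<and> (\<forall>x y. y \<in> \<alpha> \<and> (x, y) \<in> r \<longrightarrow> x \<in> \<alpha>)}"

definition minimal_in :: "'a rel \<Rightarrow> 'a set \<Rightarrow> 'a \<Rightarrow> bool" where
  "minimal_in r A q \<longleftrightarrow> q \<in> A \<and> (\<forall>p\<in>A. (p, q) \<in> r \<longrightarrow> p = q)"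

text \<open>The domain is a set \<open>A\<close> closed under \<open>sup\<close> and \<open>inf\<close> and containing \<open>bot\<close>. Its greatest element
  \<open>t\<close> is a separate argument because the greatest down-set of a poset is its carrier, not
  \<open>UNIV\<close>. The values of \<open>f\<close> outside \<open>A\<close> are irrelevant.\<close>

definition bounded_lattice_hom_on ::
  "'a::bounded_lattice_bot set \<Rightarrow> 'a \<Rightarrow> ('a \<Rightarrow> 'b::bounded_lattice) \<Rightarrow> bool" where
  "bounded_lattice_hom_on A t f \<longleftrightarrow>
     f bot = bot \<and> f t = top \<and>
     (\<forall>x\<in>A. \<forall>y\<in>A. f (sup x y) = sup (f x) (f y) \<and> f (inf x y) = inf (f x) (f y))"

definition lattice_epimorphism :: "('k::bounded_lattice \<Rightarrow> 'l::bounded_lattice) \<Rightarrow> bool" where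
  "lattice_epimorphism h \<longleftrightarrow> bounded_lattice_hom_on UNIV top h \<and> surj h"

definition downset_embedding ::
  "'a set \<Rightarrow> 'a rel \<Rightarrow> ('a set \<Rightarrow> 'l::bounded_lattice) \<Rightarrow> bool" where
  "downset_embedding P r s \<longleftrightarrow>
     bounded_lattice_hom_on (downsets P r) P s \<and> inj_on s (downsets P r)"

definition downsets_top :: "'a set \<Rightarrow> 'a rel \<Rightarrow> 'a set \<Rightarrow> 'a set set" where
  "downsets_top P r \<Lambda> = {\<alpha> \<in> downsets P r. \<alpha> \<subseteq> \<Lambda> \<or> \<alpha> = P}"

definition partial_lift ::
  "('k::bounded_lattice \<Rightarrow> 'l::bounded_lattice) \<Rightarrow> 'a set \<Rightarrow> 'a rel \<Rightarrow> ('a set \<Rightarrow> 'l) \<Rightarrow>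
     'a set \<Rightarrow> ('a set \<Rightarrow> 'k) \<Rightarrow> bool" where
  "partial_lift h P r s \<Lambda> k \<longleftrightarrow>
     bounded_lattice_hom_on (downsets_top P r \<Lambda>) P k \<and>
     (\<forall>\<beta>\<in>downsets P r. \<beta> \<subseteq> \<Lambda> \<longrightarrow> h (k \<beta>) = s \<beta>)"

definition conditional_lift ::
  "('k::bounded_lattice \<Rightarrow> 'l::bounded_lattice) \<Rightarrow> 'a set \<Rightarrow> 'a rel \<Rightarrow> ('a set \<Rightarrow> 'l) \<Rightarrow>
     'a set \<Rightarrow> ('a set \<Rightarrow> 'k) \<Rightarrow> bool" where
  "conditional_lift h P r s \<Lambda> k \<longleftrightarrow>
     partial_lift h P r s \<Lambda> k \<and>
     (\<exists>v. \<forall>\<alpha>\<in>downsets P r.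
        v \<alpha> \<in> h -` {s \<alpha>} \<and>
        (\<forall>\<beta>\<in>downsets P r. \<forall>\<gamma>\<in>downsets P r.
           \<beta> \<subseteq> \<Lambda> \<and> \<gamma> \<subseteq> \<Lambda> \<and> \<gamma> \<inter> \<alpha> \<subseteq> \<beta> \<longrightarrow> inf (k \<gamma>) (v \<alpha>) \<le> k \<beta>))"

text \<open>A definition cannot quantify over all types, so the posets range over finite sets of natural
  numbers with arbitrary partial orders; every finite poset is isomorphic to one of these.\<close>

definition spacious :: "('k::bounded_lattice \<Rightarrow> 'l::bounded_lattice) \<Rightarrow> bool" where
  "spacious h \<longleftrightarrow>
     (\<forall>(P :: nat set) r s.
        finite P \<and> partial_order_on P r \<and> downset_embedding P r s \<longrightarrow>
        (\<forall>q k. minimal_in r P q \<and> partial_lift h P r s {q} k \<longrightarrow>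
           conditional_lift h P r s {q} k) \<and>
        (\<forall>\<Lambda>\<in>downsets P r. \<forall>k q.
           partial_lift h P r s \<Lambda> k \<and> minimal_in r (P - \<Lambda>) q \<longrightarrow>
           (\<exists>v\<^sub>\<mu> v. v\<^sub>\<mu> \<in> h -` {s (under r q)} \<and>
              (\<forall>\<alpha>\<in>downsets P r. q \<notin> \<alpha> \<longrightarrow>
                 v \<alpha> \<in> h -` {s \<alpha>} \<and> inf v\<^sub>\<mu> (v \<alpha>) \<le> k \<Lambda>))))"

end

theory Submission
  imports Defs
begin

text \<open>A lift is built one element at a time along a linear extension of the poset. Suppose that \<open>k\<close>
  lifts \<open>s\<close> on the down-sets below \<open>\<Lambda>\<close>, with fibre elements \<open>v \<alpha>\<close> as in a conditional lift, and let
  \<open>q\<close> be minimal outside \<open>\<Lambda>\<close>, \<open>\<mu> = under r q\<close>. If \<open>w\<close>, \<open>u \<alpha>\<close> are the elements given by condition (ii)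
  of spaciousness, then \<open>m = k (\<mu> - {q}) \<squnion> (v \<mu> \<sqinter> w)\<close> is an admissible value at \<open>\<mu>\<close>, because
  \<open>k \<Lambda> \<sqinter> v \<mu> \<le> k (\<mu> - {q})\<close>. The extended lift is conditional again, with \<open>v \<alpha> \<sqinter> u \<alpha>\<close>
  in place of \<open>v \<alpha>\<close> when \<open>q \<notin> \<alpha>\<close>, because \<open>w \<sqinter> u \<alpha> \<le> k \<Lambda>\<close>. The hypothesis on the fibre over \<open>top\<close>
  makes the lift preserve the greatest element once \<open>\<Lambda>\<close> is the whole poset.\<close>

section \<open>Down-sets and minimal elements of a finite poset\<close>

lemma downsets_Un: "\<alpha> \<in> downsets P r \<Longrightarrow> \<beta> \<in> downsets P r \<Longrightarrow> \<alpha> \<union> \<beta> \<in> downsets P r"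
  unfolding downsets_def by blast

lemma downsets_Int: "\<alpha> \<in> downsets P r \<Longrightarrow> \<beta> \<in> downsets P r \<Longrightarrow> \<alpha> \<inter> \<beta> \<in> downsets P r"
  unfolding downsets_def by blast

lemma empty_in_downsets: "{} \<in> downsets P r"
  unfolding downsets_def by blast

lemma downsets_subset: "\<alpha> \<in> downsets P r \<Longrightarrow> \<alpha> \<subseteq> P"
  unfolding downsets_def by blast

lemma downsets_downward: "\<alpha> \<in> downsets P r \<Longrightarrow> y \<in> \<alpha> \<Longrightarrow> (x, y) \<in> r \<Longrightarrow> x \<in> \<alpha>"
  unfolding downsets_def by blast

lemma carrier_in_downsets: "partial_order_on P r \<Longrightarrow> P \<in> downsets P r"
  unfolding downsets_def partial_order_on_def preorder_on_def by blast

lemma under_in_downsets: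
  assumes "partial_order_on P r" shows "under r q \<in> downsets P r"
  using assms unfolding downsets_def under_def partial_order_on_def preorder_on_def
  by (blast dest: transD)

lemma under_subset_downset: "\<alpha> \<in> downsets P r \<Longrightarrow> q \<in> \<alpha> \<Longrightarrow> under r q \<subseteq> \<alpha>"
  unfolding downsets_def under_def by blast

lemma in_under_self: "partial_order_on P r \<Longrightarrow> q \<in> P \<Longrightarrow> q \<in> under r q"
  unfolding under_def partial_order_on_def preorder_on_def refl_on_def by blast

lemma strict_under_subset:
  assumes "partial_order_on P r" "minimal_in r (P - \<Lambda>) q"
  shows "under r q - {q} \<subseteq> \<Lambda>"
  using assms unfolding minimal_in_def under_def partial_order_on_def preorder_on_def by blast

text \<open>Minimality of \<open>q\<close> puts everything strictly below \<open>q\<close> into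
  \<Lambda>, so this set is the intersection of the down-sets \<open>under r q\<close> and
  \<Lambda>.\<close>

lemma strict_under_in_downsets:
  assumes "partial_order_on P r" "\<Lambda> \<in> downsets P r" "minimal_in r (P - \<Lambda>) q"
  shows "under r q - {q} \<in> downsets P r"
proof -
  have "under r q - {q} = under r q \<inter> \<Lambda>"
    using strict_under_subset[OF assms(1,3)] assms(3) by (auto simp: minimal_in_def)
  then show ?thesis
    using downsets_Int under_in_downsets assms(1,2) by metis
qed

lemma insert_minimal_in_downsets:
  assumes "partial_order_on P r" "\<Lambda> \<in> downsets P r" "minimal_in r (P - \<Lambda>) q"
  shows "insert q \<Lambda> \<in> downsets P r"
proof -
  have "insert q \<Lambda> = under r q \<union> \<Lambda>"
    using strict_under_subset[OF assms(1,3)] in_under_self[OF assms(1)] assms(3)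
    by (auto simp: minimal_in_def)
  then show ?thesis
    using downsets_Un under_in_downsets assms(1,2) by metis
qed

text \<open>The strict part of \<open>r\<close> is asymmetric and transitive, so it has a minimal
  element on every finite nonempty set.\<close>

lemma ex_minimal_in:
  assumes "finite P" "partial_order_on P r" "A \<subseteq> P" "A \<noteq> {}"
  shows "\<exists>q. minimal_in r A q"
proof -
  have "asymp_on A (\<lambda>x y. (x, y) \<in> r \<and> x \<noteq> y)" "transp_on A (\<lambda>x y. (x, y) \<in> r \<and> x \<noteq> y)"
    using assms(2) unfolding partial_order_on_def preorder_on_def
    by (auto intro!: asymp_onI transp_onI dest: antisymD transD)
  then obtain q where "q \<in> A" "\<forall>x\<in>A. x \<noteq> q \<longrightarrow> \<not> ((x, q) \<in> r \<and> x \<noteq> q)"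
    using Finite_Set.bex_min_element[of A "\<lambda>x y. (x, y) \<in> r \<and> x \<noteq> y"] assms finite_subset by blast
  then show ?thesis
    unfolding minimal_in_def by blast
qed

section \<open>Extending a conditional lift by one point\<close>

text \<open>A conditional lift without the requirement \<open>k P = top\<close>; this lets the inductive step treat
  \<open>insert q \<Lambda> = P\<close> like any other down-set.\<close>

definition conditional_lift_below ::
  "('k::bounded_lattice \<Rightarrow> 'l::bounded_lattice) \<Rightarrow> 'a set \<Rightarrow> 'a rel \<Rightarrow> ('a set \<Rightarrow> 'l) \<Rightarrow>
     'a set \<Rightarrow> ('a set \<Rightarrow> 'k) \<Rightarrow> ('a set \<Rightarrow> 'k) \<Rightarrow> bool" where
  "conditional_lift_below h P r s \<Lambda> k v \<longleftrightarrow>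
     k {} = bot \<and>
     (\<forall>\<beta>\<in>downsets P r. \<forall>\<gamma>\<in>downsets P r. \<beta> \<subseteq> \<Lambda> \<and> \<gamma> \<subseteq> \<Lambda> \<longrightarrow>
        k (\<beta> \<union> \<gamma>) = sup (k \<beta>) (k \<gamma>) \<and> k (\<beta> \<inter> \<gamma>) = inf (k \<beta>) (k \<gamma>)) \<and>
     (\<forall>\<beta>\<in>downsets P r. \<beta> \<subseteq> \<Lambda> \<longrightarrow> h (k \<beta>) = s \<beta>) \<and>
     (\<forall>\<alpha>\<in>downsets P r. h (v \<alpha>) = s \<alpha> \<and>
        (\<forall>\<beta>\<in>downsets P r. \<forall>\<gamma>\<in>downsets P r.
           \<beta> \<subseteq> \<Lambda> \<and> \<gamma> \<subseteq> \<Lambda> \<and> \<gamma> \<inter> \<alpha> \<subseteq> \<beta> \<longrightarrow> inf (k \<gamma>) (v \<alpha>) \<le> k \<beta>))"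

text \<open>This is the form in which \<open>spacious\<close> can be applied. Resetting the value at
  \<open>P\<close> disturbs nothing below \<Lambda>, since \<Lambda> is a proper subset of
  \<open>P\<close>.\<close>

lemma partial_lift_of_conditional_lift_below:
  assumes k: "conditional_lift_below h P r s \<Lambda> k v"
    and \<Lambda>: "\<Lambda> \<subset> P" and s: "s P = top" and h: "h top = top"
  shows "partial_lift h P r s \<Lambda> (k(P := top))"
proof -
  have ne: "\<beta> \<subseteq> \<Lambda> \<Longrightarrow> \<beta> \<noteq> P" for \<beta>
    using \<Lambda> by blast
  have "P \<noteq> {}"
    using \<Lambda> by blast
  have "(k(P := top)) (sup x y) = sup ((k(P := top)) x) ((k(P := top)) y) \<and>
      (k(P := top)) (inf x y) = inf ((k(P := top)) x) ((k(P := top)) y)"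
    if x: "x \<in> downsets_top P r \<Lambda>" and y: "y \<in> downsets_top P r \<Lambda>" for x y
  proof -
    consider "x = P" | "y = P" | "x \<subseteq> \<Lambda>" "y \<subseteq> \<Lambda>"
      using x y unfolding downsets_top_def by blast
    then show ?thesis
    proof cases
      case 1
      then have "x \<union> y = P" "x \<inter> y = y"
        using y unfolding downsets_top_def downsets_def by blast+
      then show ?thesis using 1 by simp
    next
      case 2
      then have "x \<union> y = P" "x \<inter> y = x"
        using x unfolding downsets_top_def downsets_def by blast+
      then show ?thesis using 2 by simp
    next
      case 3
      then have "x \<noteq> P" "y \<noteq> P" "x \<union> y \<noteq> P" "x \<inter> y \<noteq> P"
        by (auto intro!: ne)
      then show ?thesis
        using 3 x y k unfolding downsets_top_def conditional_lift_below_def by simp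
    qed
  qed
  moreover have "(k(P := top)) bot = bot"
    using k \<open>P \<noteq> {}\<close> unfolding conditional_lift_below_def by simp
  ultimately show ?thesis
    using k s h unfolding partial_lift_def bounded_lattice_hom_on_def conditional_lift_below_def
    by simp
qed

text \<open>A down-set inside \<open>insert q \<Lambda>\<close> either lies in \<Lambda> or is the
  union of its trace on \<Lambda> with \<open>under r q\<close>. A join-preserving extension of
  \<open>k\<close> is therefore determined by its value at \<open>under r q\<close>; what has to be
  checked is that meets and conditionality survive.\<close>

lemma conditional_lift_below_insert:
  fixes h :: "'k::{distrib_lattice, bounded_lattice} \<Rightarrow> 'l::{distrib_lattice, bounded_lattice}"
  assumes po: "partial_order_on P r"
    and h: "bounded_lattice_hom_on UNIV top h"
    and s: "bounded_lattice_hom_on (downsets P r) P s"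
    and \<Lambda>: "\<Lambda> \<in> downsets P r"
    and q: "minimal_in r (P - \<Lambda>) q"
    and k: "conditional_lift_below h P r s \<Lambda> k v"
    and w: "h w = s (under r q)"
    and u: "\<And>\<alpha>. \<alpha> \<in> downsets P r \<Longrightarrow> q \<notin> \<alpha> \<Longrightarrow> h (u \<alpha>) = s \<alpha> \<and> inf w (u \<alpha>) \<le> k \<Lambda>"
  shows "\<exists>k' v'. conditional_lift_below h P r s (insert q \<Lambda>) k' v'"
proof -
  let ?D = "downsets P r"
  define \<mu> where "\<mu> = under r q"
  \<comment> \<open>The joinand \<open>k (\<mu> - {q})\<close> ensures \<open>k' \<mu> = m\<close>;
    the factor \<open>v \<mu>\<close> controls meets with values of \<open>k\<close>, and
    \<open>w\<close> is needed for conditionality.\<close>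
  define m where "m = sup (k (\<mu> - {q})) (inf (v \<mu>) w)"
  \<comment> \<open>Taking the trace on \<Lambda> lets the join, meet and conditionality laws be
    proved for all down-sets; only \<open>hk'\<close> needs the bound
    \<open>insert q \<Lambda>\<close>.\<close>
  define k' where "k' \<alpha> = sup (k (\<alpha> \<inter> \<Lambda>)) (if q \<in> \<alpha> then m else bot)" for \<alpha>
  \<comment> \<open>The elements \<open>u \<alpha>\<close> are available only when \<open>q\<close>
    is not in \<alpha>. Both factors lie over \<open>s \<alpha>\<close>, hence so does their
    meet.\<close>
  define v' where "v' \<alpha> = (if q \<in> \<alpha> then v \<alpha> else inf (v \<alpha>) (u \<alpha>))" for \<alpha>
  have h_sup: "h (sup x y) = sup (h x) (h y)" and h_inf: "h (inf x y) = inf (h x) (h y)" for x y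
    using h unfolding bounded_lattice_hom_on_def by auto
  have s_sup: "\<lbrakk>\<beta> \<in> ?D; \<gamma> \<in> ?D\<rbrakk> \<Longrightarrow> s (\<beta> \<union> \<gamma>) = sup (s \<beta>) (s \<gamma>)" for \<beta> \<gamma>
    using s unfolding bounded_lattice_hom_on_def by auto
  have k_bot: "k {} = bot"
    and k_sup: "\<lbrakk>\<beta> \<in> ?D; \<gamma> \<in> ?D; \<beta> \<subseteq> \<Lambda>; \<gamma> \<subseteq> \<Lambda>\<rbrakk> \<Longrightarrow> k (\<beta> \<union> \<gamma>) = sup (k \<beta>) (k \<gamma>)"
    and k_inf: "\<lbrakk>\<beta> \<in> ?D; \<gamma> \<in> ?D; \<beta> \<subseteq> \<Lambda>; \<gamma> \<subseteq> \<Lambda>\<rbrakk> \<Longrightarrow> k (\<beta> \<inter> \<gamma>) = inf (k \<beta>) (k \<gamma>)"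
    and hk: "\<lbrakk>\<beta> \<in> ?D; \<beta> \<subseteq> \<Lambda>\<rbrakk> \<Longrightarrow> h (k \<beta>) = s \<beta>"
    and hv: "\<alpha> \<in> ?D \<Longrightarrow> h (v \<alpha>) = s \<alpha>"
    and kv: "\<lbrakk>\<alpha> \<in> ?D; \<beta> \<in> ?D; \<gamma> \<in> ?D; \<beta> \<subseteq> \<Lambda>; \<gamma> \<subseteq> \<Lambda>; \<gamma> \<inter> \<alpha> \<subseteq> \<beta>\<rbrakk> \<Longrightarrow> inf (k \<gamma>) (v \<alpha>) \<le> k \<beta>"
    for \<alpha> \<beta> \<gamma>
    using k unfolding conditional_lift_below_def by auto
  have k_mono: "k \<beta> \<le> k \<gamma>" if "\<beta> \<in> ?D" "\<gamma> \<in> ?D" "\<gamma> \<subseteq> \<Lambda>" "\<beta> \<subseteq> \<gamma>" for \<beta> \<gamma>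
    using k_sup[of \<beta> \<gamma>] that by (metis Un_absorb1 order_trans sup_ge1)
  have \<mu>_in: "\<mu> \<in> ?D" "\<mu> - {q} \<in> ?D" and \<mu>_sub: "\<mu> - {q} \<subseteq> \<Lambda>" and q_\<mu>: "q \<in> \<mu>" and q_\<Lambda>: "q \<notin> \<Lambda>"
    using under_in_downsets[OF po] strict_under_in_downsets[OF po \<Lambda> q] strict_under_subset[OF po q]
      in_under_self[OF po] q
    by (auto simp: \<mu>_def minimal_in_def)
  have \<Lambda>_Int: "\<beta> \<inter> \<Lambda> \<in> ?D" if "\<beta> \<in> ?D" for \<beta>
    using downsets_Int that \<Lambda> .
  have \<mu>_le: "\<mu> \<subseteq> \<beta>" if "\<beta> \<in> ?D" "q \<in> \<beta>" for \<beta>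
    using under_subset_downset that unfolding \<mu>_def .
  \<comment> \<open>Conditionality of \<open>k\<close> applies because \<open>q\<close> is not in
    \<Lambda>, so that \<Lambda> meets \<mu> inside \<open>\<mu> - {q}\<close>.\<close>
  have v\<mu>: "inf (k \<Lambda>) (v \<mu>) \<le> k (\<mu> - {q})"
    using kv[of \<mu> "\<mu> - {q}" \<Lambda>] \<mu>_in \<mu>_sub \<Lambda> q_\<Lambda> by blast
  have m_\<Lambda>: "inf m (k \<Lambda>) \<le> k (\<mu> - {q})"
  proof -
    have "inf m (k \<Lambda>) = sup (inf (k (\<mu> - {q})) (k \<Lambda>)) (inf (inf (k \<Lambda>) (v \<mu>)) w)"
      unfolding m_def by (simp add: inf_sup_distrib1 inf_aci)
    also have "\<dots> \<le> k (\<mu> - {q})"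
      using v\<mu> by (simp add: le_infI1)
    finally show ?thesis .
  qed
  \<comment> \<open>Enlarging \<gamma> to \<Lambda> brings the meet below
    \<open>k (\<mu> - {q})\<close>, hence below \<open>k \<beta>\<close>; it is also below
    \<open>k \<gamma>\<close>.\<close>
  have m_inf: "inf m (k \<gamma>) \<le> k (\<beta> \<inter> \<gamma>)"
    if "\<beta> \<in> ?D" "\<gamma> \<in> ?D" "\<beta> \<subseteq> \<Lambda>" "\<gamma> \<subseteq> \<Lambda>" "\<mu> - {q} \<subseteq> \<beta>" for \<beta> \<gamma>
  proof -
    have "inf m (k \<gamma>) \<le> inf m (k \<Lambda>)"
      using k_mono[of \<gamma> \<Lambda>] that \<Lambda> by (simp add: le_infI2)
    also have "\<dots> \<le> k \<beta>"
      using m_\<Lambda> k_mono[of "\<mu> - {q}" \<beta>] that \<mu>_in by auto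
    finally show ?thesis
      using k_inf[of \<beta> \<gamma>] that by simp
  qed
  have hm: "h m = s \<mu>"
  proof -
    have "h m = sup (s (\<mu> - {q})) (s \<mu>)"
      using hk hv \<mu>_in \<mu>_sub w by (simp add: m_def h_sup h_inf \<mu>_def)
    also have "\<dots> = s ((\<mu> - {q}) \<union> \<mu>)"
      using s_sup \<mu>_in by simp
    also have "(\<mu> - {q}) \<union> \<mu> = \<mu>"
      by blast
    finally show ?thesis .
  qed
  have k'_sup: "k' (\<beta> \<union> \<gamma>) = sup (k' \<beta>) (k' \<gamma>)" if "\<beta> \<in> ?D" "\<gamma> \<in> ?D" for \<beta> \<gamma>
    using k_sup[of "\<beta> \<inter> \<Lambda>" "\<gamma> \<inter> \<Lambda>"] \<Lambda>_Int that
    by (simp add: k'_def Int_Un_distrib2 sup_commute sup_left_commute)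
  \<comment> \<open>In this mixed case distributivity leaves the extra joinand
    \<open>inf m (k (\<gamma> \<inter> \<Lambda>))\<close>, which \<open>m_inf\<close> absorbs
    because \<beta> contains \<mu>.\<close>
  have k'_inf_one: "k' (\<beta> \<inter> \<gamma>) = inf (k' \<beta>) (k' \<gamma>)"
    if "\<beta> \<in> ?D" "\<gamma> \<in> ?D" "q \<in> \<beta>" "q \<notin> \<gamma>" for \<beta> \<gamma>
  proof -
    have Int: "\<beta> \<inter> \<gamma> \<inter> \<Lambda> = \<beta> \<inter> \<Lambda> \<inter> (\<gamma> \<inter> \<Lambda>)"
      by blast
    have "inf (k' \<beta>) (k' \<gamma>) = sup (k (\<beta> \<inter> \<Lambda> \<inter> (\<gamma> \<inter> \<Lambda>))) (inf m (k (\<gamma> \<inter> \<Lambda>)))"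
      using k_inf[of "\<beta> \<inter> \<Lambda>" "\<gamma> \<inter> \<Lambda>"] \<Lambda>_Int that by (simp add: k'_def inf_sup_distrib2)
    also have "\<dots> = k (\<beta> \<inter> \<Lambda> \<inter> (\<gamma> \<inter> \<Lambda>))"
      using m_inf[of "\<beta> \<inter> \<Lambda>" "\<gamma> \<inter> \<Lambda>"] \<Lambda>_Int that \<mu>_le[of \<beta>] \<mu>_sub
      by (intro sup_absorb1) auto
    finally show ?thesis
      using that by (simp add: k'_def Int)
  qed
  have k'_inf: "k' (\<beta> \<inter> \<gamma>) = inf (k' \<beta>) (k' \<gamma>)" if "\<beta> \<in> ?D" "\<gamma> \<in> ?D" for \<beta> \<gamma>
  proof (cases "q \<in> \<beta> \<longleftrightarrow> q \<in> \<gamma>")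
    case True
    have "\<beta> \<inter> \<gamma> \<inter> \<Lambda> = \<beta> \<inter> \<Lambda> \<inter> (\<gamma> \<inter> \<Lambda>)"
      by blast
    then have "k (\<beta> \<inter> \<gamma> \<inter> \<Lambda>) = inf (k (\<beta> \<inter> \<Lambda>)) (k (\<gamma> \<inter> \<Lambda>))"
      using k_inf[of "\<beta> \<inter> \<Lambda>" "\<gamma> \<inter> \<Lambda>"] \<Lambda>_Int that by simp
    then show ?thesis
      using True by (simp add: k'_def sup_inf_distrib2)
  next
    case False
    then show ?thesis
      using k'_inf_one that by (metis Int_commute inf_commute)
  qed
  have hk': "h (k' \<beta>) = s \<beta>" if "\<beta> \<in> ?D" "\<beta> \<subseteq> insert q \<Lambda>" for \<beta>
  proof (cases "q \<in> \<beta>")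
    case True
    have "(\<beta> \<inter> \<Lambda>) \<union> \<mu> = \<beta>"
      using True that \<mu>_le[of \<beta>] q_\<mu> by auto
    then show ?thesis
      using True hk[of "\<beta> \<inter> \<Lambda>"] \<Lambda>_Int[of \<beta>] that s_sup[of "\<beta> \<inter> \<Lambda>" \<mu>] \<mu>_in
      by (simp add: k'_def h_sup hm)
  next
    case False
    then have "\<beta> \<inter> \<Lambda> = \<beta>"
      using that by auto
    then show ?thesis
      using False hk[of \<beta>] that by (auto simp: k'_def)
  qed
  have hv': "h (v' \<alpha>) = s \<alpha>" if "\<alpha> \<in> ?D" for \<alpha>
    using that hv u by (simp add: v'_def h_inf)
  have v'_le: "v' \<alpha> \<le> v \<alpha>" for \<alpha>
    by (simp add: v'_def)
  \<comment> \<open>Here the choice of \<open>w\<close> and \<open>u\<close> enters: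
    \<open>inf w (u \<alpha>)\<close> is below \<open>k \<Lambda>\<close>, so the joinand
    \<open>inf (v \<mu>) w\<close> of \<open>m\<close>, met with \<open>v' \<alpha>\<close>, drops
    below \<open>k (\<mu> - {q})\<close>. Conditionality of \<open>k\<close> then gives the bound
    \<open>k \<beta>\<close>.\<close>
  have m_v': "inf m (v' \<alpha>) \<le> k \<beta>"
    if "\<alpha> \<in> ?D" "\<beta> \<in> ?D" "\<beta> \<subseteq> \<Lambda>" "q \<notin> \<alpha>" "(\<mu> - {q}) \<inter> \<alpha> \<subseteq> \<beta>" for \<alpha> \<beta>
  proof -
    have "inf (inf (v \<mu>) w) (v' \<alpha>) \<le> inf (inf w (u \<alpha>)) (v \<mu>)"
      using that by (simp add: v'_def le_infI1 le_infI2)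
    also have "\<dots> \<le> inf (k \<Lambda>) (v \<mu>)"
      using u that by (intro inf_mono) auto
    also have "\<dots> \<le> k (\<mu> - {q})"
      by (fact v\<mu>)
    finally have "inf m (v' \<alpha>) \<le> inf (k (\<mu> - {q})) (v \<alpha>)"
      unfolding m_def using v'_le by (simp add: inf_sup_distrib2 le_infI2)
    also have "\<dots> \<le> k \<beta>"
      using kv[of \<alpha> \<beta> "\<mu> - {q}"] that \<mu>_in \<mu>_sub by blast
    finally show ?thesis .
  qed
  have k'v': "inf (k' \<gamma>) (v' \<alpha>) \<le> k' \<beta>"
    if "\<alpha> \<in> ?D" "\<beta> \<in> ?D" "\<gamma> \<in> ?D" "\<gamma> \<inter> \<alpha> \<subseteq> \<beta>" for \<alpha> \<beta> \<gamma>
  proof -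
    have "inf (k (\<gamma> \<inter> \<Lambda>)) (v' \<alpha>) \<le> inf (k (\<gamma> \<inter> \<Lambda>)) (v \<alpha>)"
      using v'_le by (simp add: le_infI2)
    also have "\<dots> \<le> k (\<beta> \<inter> \<Lambda>)"
      using kv[of \<alpha> "\<beta> \<inter> \<Lambda>" "\<gamma> \<inter> \<Lambda>"] \<Lambda>_Int that by blast
    also have "\<dots> \<le> k' \<beta>"
      by (simp add: k'_def)
    finally have 1: "inf (k (\<gamma> \<inter> \<Lambda>)) (v' \<alpha>) \<le> k' \<beta>" .
    \<comment> \<open>If \<open>q\<close> is in \<alpha>, it is in \<beta> too and \<open>m\<close>
      is itself a joinand of \<open>k' \<beta>\<close>. Otherwise \<open>m_v'\<close> applies to the
      trace of \<beta> on \<Lambda>.\<close>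
    have 2: "inf m (v' \<alpha>) \<le> k' \<beta>" if "q \<in> \<gamma>"
    proof (cases "q \<in> \<alpha>")
      case True
      then have "q \<in> \<beta>"
        using \<open>\<gamma> \<inter> \<alpha> \<subseteq> \<beta>\<close> \<open>q \<in> \<gamma>\<close> by blast
      then show ?thesis
        by (simp add: k'_def le_infI1 le_supI2)
    next
      case False
      have "(\<mu> - {q}) \<inter> \<alpha> \<subseteq> \<beta> \<inter> \<Lambda>"
        using \<mu>_le[of \<gamma>] \<mu>_sub \<open>\<gamma> \<in> ?D\<close> \<open>q \<in> \<gamma>\<close> \<open>\<gamma> \<inter> \<alpha> \<subseteq> \<beta>\<close> by blast
      then have "inf m (v' \<alpha>) \<le> k (\<beta> \<inter> \<Lambda>)"
        using m_v'[of \<alpha> "\<beta> \<inter> \<Lambda>"] False \<open>\<alpha> \<in> ?D\<close> \<Lambda>_Int[OF \<open>\<beta> \<in> ?D\<close>] by blast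
      then show ?thesis
        by (simp add: k'_def le_supI1)
    qed
    show ?thesis
      using 1 2 by (simp add: k'_def[of \<gamma>] inf_sup_distrib2)
  qed
  have "conditional_lift_below h P r s (insert q \<Lambda>) k' v'"
    unfolding conditional_lift_below_def
    using k'_sup k'_inf hk' hv' k'v' by (simp add: k'_def k_bot)
  then show ?thesis
    by blast
qed

text \<open>This starts the construction: the only down-set to be lifted is empty, and surjectivity
  of \<open>h\<close> supplies the fibre elements.\<close>

lemma conditional_lift_below_empty:
  assumes "lattice_epimorphism h" "bounded_lattice_hom_on (downsets P r) P s"
  shows "conditional_lift_below h P r s {} (\<lambda>_. bot) (\<lambda>\<alpha>. inv h (s \<alpha>))"
  using assms
  unfolding conditional_lift_below_def lattice_epimorphism_def bounded_lattice_hom_on_def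
  by (auto simp: surj_f_inv_f)

section \<open>Lifts for posets of natural numbers\<close>

text \<open>There are finitely many down-sets, so some \<Lambda> is maximal among those carrying a
  conditional lift. If it were proper, the one-point extension would contradict maximality. The
  carrier consists of natural numbers to match \<open>spacious\<close>.\<close>

lemma downset_embedding_lifts_nat:
  fixes h :: "'k::{distrib_lattice, bounded_lattice} \<Rightarrow> 'l::{distrib_lattice, bounded_lattice}"
    and P :: "nat set"
  assumes h: "lattice_epimorphism h" and sp: "spacious h" and top: "h -` {top} = {top}"
    and fin: "finite P" and po: "partial_order_on P r" and emb: "downset_embedding P r s"
  shows "\<exists>k. bounded_lattice_hom_on (downsets P r) P k \<and> (\<forall>\<alpha>\<in>downsets P r. h (k \<alpha>) = s \<alpha>)"
proof -
  have h_hom: "bounded_lattice_hom_on UNIV top h" and h_top: "h top = top"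
    using h unfolding lattice_epimorphism_def bounded_lattice_hom_on_def by auto
  have s_hom: "bounded_lattice_hom_on (downsets P r) P s" and s_top: "s P = top"
    using emb unfolding downset_embedding_def bounded_lattice_hom_on_def by auto
  let ?G = "{\<Lambda> \<in> downsets P r. \<exists>k v. conditional_lift_below h P r s \<Lambda> k v}"
  have "finite ?G"
    by (rule finite_subset[of _ "Pow P"]) (auto simp: fin dest: downsets_subset)
  moreover have "{} \<in> ?G"
    using empty_in_downsets conditional_lift_below_empty[OF h s_hom] by blast
  ultimately obtain \<Lambda> where "\<Lambda> \<in> ?G" and max: "\<forall>\<Lambda>'\<in>?G. \<Lambda> \<subseteq> \<Lambda>' \<longrightarrow> \<Lambda> = \<Lambda>'"
    using finite_has_maximal[of ?G] by blast
  then obtain k v where \<Lambda>: "\<Lambda> \<in> downsets P r" and k: "conditional_lift_below h P r s \<Lambda> k v"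
    by blast
  have "\<Lambda> = P"
  proof (rule ccontr)
    assume "\<Lambda> \<noteq> P"
    then have "\<Lambda> \<subset> P"
      using downsets_subset[OF \<Lambda>] by blast
    then obtain q where q: "minimal_in r (P - \<Lambda>) q"
      using ex_minimal_in[OF fin po, of "P - \<Lambda>"] by blast
    have lift: "partial_lift h P r s \<Lambda> (k(P := top))"
      using partial_lift_of_conditional_lift_below[OF k \<open>\<Lambda> \<subset> P\<close> s_top h_top] .
    have "\<exists>w u. w \<in> h -` {s (under r q)} \<and> (\<forall>\<alpha>\<in>downsets P r. q \<notin> \<alpha> \<longrightarrow>
        u \<alpha> \<in> h -` {s \<alpha>} \<and> inf w (u \<alpha>) \<le> (k(P := top)) \<Lambda>)"
      \<comment> \<open>This is the second clause of \<open>spacious\<close>. Its bound is the reset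
        lift at \<Lambda>, which equals \<open>k \<Lambda>\<close> because \<Lambda> differs from
        \<open>P\<close>.\<close>
      using sp fin po emb \<Lambda> lift q unfolding spacious_def by blast
    then obtain w u where "h w = s (under r q)"
      "\<forall>\<alpha>\<in>downsets P r. q \<notin> \<alpha> \<longrightarrow> h (u \<alpha>) = s \<alpha> \<and> inf w (u \<alpha>) \<le> k \<Lambda>"
      using \<open>\<Lambda> \<noteq> P\<close> by auto
    then have "\<exists>k' v'. conditional_lift_below h P r s (insert q \<Lambda>) k' v'"
      using conditional_lift_below_insert[OF po h_hom s_hom \<Lambda> q k] by blast
    then have "insert q \<Lambda> \<in> ?G"
      using insert_minimal_in_downsets[OF po \<Lambda> q] by blast
    then have "\<Lambda> = insert q \<Lambda>"
      using max by blast
    then show False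
      using q unfolding minimal_in_def by blast
  qed
  have lifts: "h (k \<alpha>) = s \<alpha>" if "\<alpha> \<in> downsets P r" for \<alpha>
    using k \<open>\<Lambda> = P\<close> that downsets_subset[OF that] unfolding conditional_lift_below_def by blast
  \<comment> \<open>The element \<open>k P\<close> lies over \<open>s P = top\<close>, and that
    fibre is a singleton.\<close>
  then have "k P = top"
    using top s_top carrier_in_downsets[OF po] by auto
  then have "bounded_lattice_hom_on (downsets P r) P k"
    using k \<open>\<Lambda> = P\<close> downsets_subset[of _ P r]
    unfolding conditional_lift_below_def bounded_lattice_hom_on_def by simp
  then show ?thesis
    using lifts by blast
qed

section \<open>Transport to an isomorphic poset of natural numbers\<close>

text \<open>A pair of the image relation may come with another preimage of its upper end than the
  chosen one in \<alpha>; injectivity on \<open>P\<close> identifies the two.\<close>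

lemma image_in_downsets:
  assumes "inj_on f P" "r \<subseteq> P \<times> P" "\<alpha> \<in> downsets P r"
  shows "f ` \<alpha> \<in> downsets (f ` P) (map_prod f f ` r)"
proof -
  have "x \<in> f ` \<alpha>" if "y \<in> f ` \<alpha>" and xy: "(x, y) \<in> map_prod f f ` r" for x y
  proof -
    obtain b where b: "b \<in> \<alpha>" "y = f b"
      using \<open>y \<in> f ` \<alpha>\<close> by blast
    obtain a b' where ab: "(a, b') \<in> r" "x = f a" "y = f b'"
      using xy by auto
    have "b \<in> P" "b' \<in> P"
      using b(1) ab(1) assms(2) downsets_subset[OF assms(3)] by auto
    then have "b' = b"
      using b(2) ab(3) inj_onD[OF assms(1)] by simp
    then have "a \<in> \<alpha>"
      using ab(1) b(1) downsets_downward[OF assms(3)] by simp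
    then show ?thesis
      using ab(2) by blast
  qed
  moreover have "f ` \<alpha> \<subseteq> f ` P"
    using downsets_subset[OF assms(3)] by (rule image_mono)
  ultimately show ?thesis
    unfolding downsets_def mem_Collect_eq by iprover
qed

lemma vimage_in_downsets:
  assumes "r \<subseteq> P \<times> P" "\<beta> \<in> downsets (f ` P) (map_prod f f ` r)"
  shows "f -` \<beta> \<inter> P \<in> downsets P r"
proof -
  have "x \<in> f -` \<beta> \<inter> P" if "y \<in> f -` \<beta> \<inter> P" and xy: "(x, y) \<in> r" for x y
  proof -
    have "f y \<in> \<beta>"
      using that(1) by simp
    moreover have "(f x, f y) \<in> map_prod f f ` r"
      using xy by force
    ultimately have "f x \<in> \<beta>"
      by (rule downsets_downward[OF assms(2)])
    then show ?thesis
      using xy assms(1) by blast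
  qed
  then show ?thesis
    unfolding downsets_def by blast
qed

text \<open>Chaining two image pairs requires equal preimages of the shared points, which is where
  injectivity on \<open>P\<close> enters.\<close>

lemma partial_order_on_image:
  assumes "inj_on f P" "partial_order_on P r"
  shows "partial_order_on (f ` P) (map_prod f f ` r)"
proof -
  have r: "r \<subseteq> P \<times> P" "refl_on P r" "trans r" "antisym r"
    using assms(2) unfolding partial_order_on_def preorder_on_def by auto
  have "trans (map_prod f f ` r)"
  proof (rule transI)
    fix x y z assume "(x, y) \<in> map_prod f f ` r" "(y, z) \<in> map_prod f f ` r"
    then obtain a b b' c where *: "(a, b) \<in> r" "(b', c) \<in> r" "x = f a" "z = f c" "f b = f b'"
      by auto
    then have "b = b'"
      using r(1) assms(1) by (auto dest: inj_onD)
    then show "(x, z) \<in> map_prod f f ` r"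
      using * r(3) by (auto dest: transD)
  qed
  moreover have "antisym (map_prod f f ` r)"
  proof (rule antisymI)
    fix x y assume "(x, y) \<in> map_prod f f ` r" "(y, x) \<in> map_prod f f ` r"
    then obtain a b a' b' where *: "(a, b) \<in> r" "(b', a') \<in> r" "x = f a" "y = f b"
      "f b = f b'" "f a = f a'"
      by auto
    then have "b = b'" "a = a'"
      using r(1) assms(1) by (auto dest: inj_onD)
    then show "x = y"
      using * r(4) by (auto dest: antisymD)
  qed
  moreover have "refl_on (f ` P) (map_prod f f ` r)" "map_prod f f ` r \<subseteq> f ` P \<times> f ` P"
    using r(1,2) unfolding refl_on_def by auto
  ultimately show ?thesis
    unfolding partial_order_on_def preorder_on_def by blast
qed

lemma downset_embedding_image:
  assumes f: "inj_on f P" and r: "r \<subseteq> P \<times> P" and s: "downset_embedding P r s"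
  shows "downset_embedding (f ` P) (map_prod f f ` r) (\<lambda>\<beta>. s (f -` \<beta> \<inter> P))"
proof -
  let ?D = "downsets (f ` P) (map_prod f f ` r)"
  have Un: "f -` (x \<union> y) \<inter> P = (f -` x \<inter> P) \<union> (f -` y \<inter> P)"
    and Int: "f -` (x \<inter> y) \<inter> P = (f -` x \<inter> P) \<inter> (f -` y \<inter> P)" for x y
    by auto
  have P: "f -` f ` P \<inter> P = P"
    by auto
  have hom: "bounded_lattice_hom_on (downsets P r) P s" and inj: "inj_on s (downsets P r)"
    using s unfolding downset_embedding_def by auto
  have "s (f -` (x \<union> y) \<inter> P) = sup (s (f -` x \<inter> P)) (s (f -` y \<inter> P)) \<and>
      s (f -` (x \<inter> y) \<inter> P) = inf (s (f -` x \<inter> P)) (s (f -` y \<inter> P))"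
    if "x \<in> ?D" "y \<in> ?D" for x y
    unfolding Un Int
    using hom vimage_in_downsets[OF r that(1)] vimage_in_downsets[OF r that(2)]
    unfolding bounded_lattice_hom_on_def by blast
  then have "bounded_lattice_hom_on ?D (f ` P) (\<lambda>\<beta>. s (f -` \<beta> \<inter> P))"
    using hom unfolding bounded_lattice_hom_on_def by (simp add: P)
  moreover have "inj_on (\<lambda>\<beta>. s (f -` \<beta> \<inter> P)) ?D"
  proof (rule inj_onI)
    fix x y assume x: "x \<in> ?D" and y: "y \<in> ?D" and "s (f -` x \<inter> P) = s (f -` y \<inter> P)"
    then have "f -` x \<inter> P = f -` y \<inter> P"
      using inj_onD[OF inj] vimage_in_downsets[OF r x] vimage_in_downsets[OF r y] by blast
    then show "x = y"
      using downsets_subset[OF x] downsets_subset[OF y] by blast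
  qed
  ultimately show ?thesis
    unfolding downset_embedding_def by blast
qed

theorem theorem5p13:
  fixes h :: "'k::{distrib_lattice, bounded_lattice} \<Rightarrow> 'l::{distrib_lattice, bounded_lattice}"
    and P :: "'p set" and r :: "'p rel" and s :: "'p set \<Rightarrow> 'l"
  assumes "lattice_epimorphism h"
    and "spacious h"
    and "h -` {top} = {top}"
    and "finite P" and "partial_order_on P r"
    and "downset_embedding P r s"
  shows "\<exists>k. bounded_lattice_hom_on (downsets P r) P k \<and>
             (\<forall>\<alpha>\<in>downsets P r. (h \<circ> k) \<alpha> = s \<alpha>)"
proof -
  \<comment> \<open>Numbering the points of \<open>P\<close> gives an isomorphic copy in the range
    of posets covered by \<open>spacious\<close>.\<close>
  obtain f :: "'p \<Rightarrow> nat" where f: "inj_on f P"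
    using finite_imp_inj_to_nat_seg[OF \<open>finite P\<close>] by metis
  have r: "r \<subseteq> P \<times> P"
    using assms(5) unfolding partial_order_on_def preorder_on_def by blast
  let ?D = "downsets (f ` P) (map_prod f f ` r)"
  have "finite (f ` P)"
    using \<open>finite P\<close> by blast
  then obtain k where k: "bounded_lattice_hom_on ?D (f ` P) k"
    and lift: "\<forall>\<beta>\<in>?D. h (k \<beta>) = s (f -` \<beta> \<inter> P)"
    using downset_embedding_lifts_nat[OF assms(1-3) _ partial_order_on_image[OF f assms(5)]
        downset_embedding_image[OF f r assms(6)]] by metis
  \<comment> \<open>The lift is carried back along images under \<open>f\<close>; these preserve
    intersections because \<open>f\<close> is injective on \<open>P\<close>.\<close>
  have "bounded_lattice_hom_on (downsets P r) P (\<lambda>\<alpha>. k (f ` \<alpha>))"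
  proof -
    have "f ` (x \<inter> y) = f ` x \<inter> f ` y" if "x \<in> downsets P r" "y \<in> downsets P r" for x y
      using inj_on_image_Int[OF f] that[THEN downsets_subset] .
    then show ?thesis
      using k image_in_downsets[OF f r] unfolding bounded_lattice_hom_on_def
      by (simp add: image_Un)
  qed
  moreover have "h (k (f ` \<alpha>)) = s \<alpha>" if "\<alpha> \<in> downsets P r" for \<alpha>
  proof -
    have "f -` f ` \<alpha> \<inter> P = \<alpha>"
      using f downsets_subset[OF that] by (auto dest: inj_onD)
    then show ?thesis
      using bspec[OF lift image_in_downsets[OF f r that]] by simp
  qed
  ultimately show ?thesis
    by (auto intro!: exI[of _ "\<lambda>\<alpha>. k (f ` \<alpha>)"])
qed

end
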